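(* Let $l\in\mathbb{N}$ and let $k_1<k_2$ be arbitrary real numbers. If $\mathbb{Q}^l=Q_1\cup\ldots\cup Q_r$ with $r\in\mathbb{N}$, then there exists $1\leq i_0\leq r$ such that the set $Q_{i_0}$ has the following property: for every $k\in\mathbb{N}$ and every non-empty finite set $F\subseteq\mathbb{Q}^l$ there exist $\alpha\in\mathbb{Q}^l$, $\beta\in\mathbb{Q}\setminus\mathbb{Z}$ and $\gamma\in\mathbb{Z}^\ast$ with $dom^+(\beta)=\emptyset=dom^-(\gamma)$ and $\max dom^-(\beta)<k_1<k_2<\min dom^+(\gamma)$ such that $\alpha+(p\beta+q\gamma)F\subseteq Q_{i_0}$ for all integers $0\leq p,q\leq k$.
   Context: Notation: $\mathbb{N}=\{1,2,\ldots\}$, $\mathbb{Z}^\ast=\mathbb{Z}\setminus\{0\}$; for $\alpha\in\mathbb{Q}^l$, $c\in\mathbb{Q}$ and $F\subseteq\mathbb{Q}^l$, $\alpha+cF=\{\alpha+cf: f\in F\}$. Expansion of rationals: every rational number $q$ has a unique expression $q=\sum_{s=1}^{\infty}q_{-s}\frac{(-1)^{s}}{(s+1)!}+\sum_{r=1}^{\infty}q_{r}(-1)^{r+1}r!$ with integers $0\leq q_{-s}\leq s$ for $s\geq 1$ and $0\leq q_r\leq r$ for $r\geq 1$, all but finitely many of which are zero. Put $dom(q)=\{t\in\mathbb{Z}^\ast: q_t\neq 0\}$, $dom^-(q)=\{t\in dom(q): t<0\}$, $dom^+(q)=\{t\in dom(q): t>0\}$. *)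

theory Defs
  imports "HOL-Analysis.Finite_Cartesian_Product"
begin

text \<open>\<open>d\<close> is the digit function of an expansion of \<open>q\<close>. The condition \<open>d 0 = 0\<close> encodes that
  digits are indexed by the nonzero integers, and the sums range over the finite support.\<close>

definition is_expansion :: "rat \<Rightarrow> (int \<Rightarrow> int) \<Rightarrow> bool" where
  "is_expansion q d \<longleftrightarrow>
     d 0 = 0 \<and> finite {t. d t \<noteq> 0} \<and>
     (\<forall>s::nat. s \<ge> 1 \<longrightarrow> 0 \<le> d (- int s) \<and> d (- int s) \<le> int s) \<and>
     (\<forall>r::nat. r \<ge> 1 \<longrightarrow> 0 \<le> d (int r) \<and> d (int r) \<le> int r) \<and>
     q = (\<Sum>s | s \<ge> 1 \<and> d (- int s) \<noteq> 0. of_int (d (- int s)) * ((-1) ^ s / fact (s + 1)))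
       + (\<Sum>r | r \<ge> 1 \<and> d (int r) \<noteq> 0. of_int (d (int r)) * ((-1) ^ (r + 1) * fact r))"

text \<open>The description is well defined by \<open>ex1_is_expansion\<close> below.\<close>

definition rat_digits :: "rat \<Rightarrow> int \<Rightarrow> int" where
  "rat_digits q = (THE d. is_expansion q d)"

definition rat_dom :: "rat \<Rightarrow> int set" where
  "rat_dom q = {t. t \<noteq> 0 \<and> rat_digits q t \<noteq> 0}"

definition rat_dom_neg :: "rat \<Rightarrow> int set" where
  "rat_dom_neg q = {t \<in> rat_dom q. t < 0}"

definition rat_dom_pos :: "rat \<Rightarrow> int set" where
  "rat_dom_pos q = {t \<in> rat_dom q. t > 0}"

text \<open>To prove existence and uniqueness, both sums are merged into one over the integers. The value
  of \<open>weight\<close> at \<open>0\<close> carries no digit; it only makes the recursion \<open>weight_step\<close> uniform.\<close>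

definition weight :: "int \<Rightarrow> rat" where
  "weight t = (if t < 0 then (-1) ^ nat (- t) / fact (nat (- t) + 1)
               else (-1) ^ (nat t + 1) * fact (nat t))"

lemma is_expansion_weight:
  "is_expansion q d \<longleftrightarrow>
     finite {t. d t \<noteq> 0} \<and> (\<forall>t. 0 \<le> d t \<and> d t \<le> \<bar>t\<bar>) \<and>
     q = (\<Sum>t | d t \<noteq> 0. of_int (d t) * weight t)"
proof -
  have bnd: "d 0 = 0 \<and> (\<forall>s::nat. s \<ge> 1 \<longrightarrow> 0 \<le> d (- int s) \<and> d (- int s) \<le> int s) \<and>
     (\<forall>r::nat. r \<ge> 1 \<longrightarrow> 0 \<le> d (int r) \<and> d (int r) \<le> int r)
     \<longleftrightarrow> (\<forall>t. 0 \<le> d t \<and> d t \<le> \<bar>t\<bar>)" (is "?A \<longleftrightarrow> ?B")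
  proof
    assume A: ?A
    show ?B
    proof
      fix t
      show "0 \<le> d t \<and> d t \<le> \<bar>t\<bar>"
      proof (cases t "0::int" rule: linorder_cases)
        case less
        then have "nat (-t) \<ge> 1" "- int (nat (-t)) = t" by auto
        with A show ?thesis by (metis abs_minus_cancel abs_of_nat)
      next
        case equal
        with A show ?thesis by simp
      next
        case greater
        then have "nat t \<ge> 1" "int (nat t) = t" by auto
        with A show ?thesis by (metis abs_of_nat)
      qed
    qed
  next
    assume B: ?B
    have "0 \<le> d (- int s) \<and> d (- int s) \<le> int s" for s using B[rule_format, of "- int s"] by simp
    moreover have "0 \<le> d (int s) \<and> d (int s) \<le> int s" for s using B[rule_format, of "int s"] by simp
    moreover have "d 0 = 0" using B[rule_format, of 0] by simp
    ultimately show ?A by blast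
  qed
  have sm: "(\<Sum>t | d t \<noteq> 0. of_int (d t) * weight t)
     = (\<Sum>s | s \<ge> 1 \<and> d (- int s) \<noteq> 0. of_int (d (- int s)) * ((-1) ^ s / fact (s + 1)))
       + (\<Sum>r | r \<ge> 1 \<and> d (int r) \<noteq> 0. of_int (d (int r)) * ((-1) ^ (r + 1) * fact r))"
    if fin: "finite {t. d t \<noteq> 0}" and "d 0 = 0"
  proof -
    have split: "{t. d t \<noteq> 0} = {t. t < 0 \<and> d t \<noteq> 0} \<union> {t. t > 0 \<and> d t \<noteq> 0}"
      using \<open>d 0 = 0\<close> by auto (metis linorder_neqE_linordered_idom less_irrefl)+
    have "(\<Sum>t | d t \<noteq> 0. of_int (d t) * weight t)
      = (\<Sum>t | t < 0 \<and> d t \<noteq> 0. of_int (d t) * weight t)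
        + (\<Sum>t | t > 0 \<and> d t \<noteq> 0. of_int (d t) * weight t)"
      unfolding split by (rule sum.union_disjoint) (use fin in \<open>auto elim!: rev_finite_subset\<close>)
    also have "(\<Sum>t | t < 0 \<and> d t \<noteq> 0. of_int (d t) * weight t)
      = (\<Sum>s | s \<ge> 1 \<and> d (- int s) \<noteq> 0. of_int (d (- int s)) * ((-1) ^ s / fact (s + 1)))"
      by (rule sum.reindex_bij_witness[where i = "\<lambda>s. - int s" and j = "\<lambda>t. nat (- t)"])
         (auto simp: weight_def)
    also have "(\<Sum>t | t > 0 \<and> d t \<noteq> 0. of_int (d t) * weight t)
      = (\<Sum>r | r \<ge> 1 \<and> d (int r) \<noteq> 0. of_int (d (int r)) * ((-1) ^ (r + 1) * fact r))"
      by (rule sum.reindex_bij_witness[where i = "\<lambda>s. int s" and j = "\<lambda>t. nat t"])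
         (auto simp: weight_def)
    finally show ?thesis .
  qed
  have d0: "d 0 = 0" if "\<forall>t. 0 \<le> d t \<and> d t \<le> \<bar>t\<bar>" using that[rule_format, of 0] by simp
  show ?thesis
  proof
    assume L: "is_expansion q d"
    then have "\<forall>t. 0 \<le> d t \<and> d t \<le> \<bar>t\<bar>" using bnd unfolding is_expansion_def by blast
    with L show "finite {t. d t \<noteq> 0} \<and> (\<forall>t. 0 \<le> d t \<and> d t \<le> \<bar>t\<bar>) \<and>
       q = (\<Sum>t | d t \<noteq> 0. of_int (d t) * weight t)"
      using sm unfolding is_expansion_def by simp
  next
    assume R: "finite {t. d t \<noteq> 0} \<and> (\<forall>t. 0 \<le> d t \<and> d t \<le> \<bar>t\<bar>) \<and>
       q = (\<Sum>t | d t \<noteq> 0. of_int (d t) * weight t)"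
    then have "d 0 = 0" using d0 by blast
    with R show "is_expansion q d" using sm bnd unfolding is_expansion_def by metis
  qed
qed

lemma weight_step:
  "weight (t + 1) = weight t * of_int ((if t = -1 then 1 else -1) * (\<bar>t\<bar> + 1))"
proof -
  consider (neg) n where "t = - int (Suc (Suc n))" | (m1) "t = -1" | (pos) n where "t = int n"
  proof (cases "t < -1")
    case True
    then have "t = - int (Suc (Suc (nat (- t - 2))))" by simp
    then show ?thesis using that(1) by blast
  next
    case False
    then have "t = -1 \<or> t = int (nat t)" by auto
    then show ?thesis using that(2,3) by blast
  qed
  then show ?thesis
  proof cases
    case neg
    then have "nat (- t) = Suc (Suc n)" "nat (- (t + 1)) = Suc n" "t < 0" "t + 1 < 0" "t \<noteq> -1"
      "\<bar>t\<bar> = int n + 2" by auto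
    then show ?thesis by (simp add: weight_def divide_simps add_nonneg_eq_0_iff) (simp add: algebra_simps)
  next
    case m1
    then show ?thesis by (simp add: weight_def)
  next
    case pos
    then have "nat (t + 1) = Suc n" by auto
    with pos show ?thesis by (simp add: weight_def algebra_simps)
  qed
qed

lemma weight_nonzero: "weight t \<noteq> 0"
  by (simp add: weight_def)

lemma weight_dvd:
  assumes "t < u"
  shows "\<exists>c::int. weight u = weight t * of_int ((\<bar>t\<bar> + 1) * c)"
proof -
  from assms have "t + 1 \<le> u" by simp
  then show ?thesis
  proof (induction u rule: int_ge_induct)
    case base
    show ?case by (rule exI[of _ "if t = -1 then 1 else -1"]) (simp add: weight_step)
  next
    case (step u)
    then obtain c where "weight u = weight t * of_int ((\<bar>t\<bar> + 1) * c)" by blast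
    then show ?case
      by (intro exI[of _ "c * ((if u = -1 then 1 else -1) * (\<bar>u\<bar> + 1))"])
         (simp only: weight_step of_int_mult mult.assoc)
  qed
qed

lemma weighted_sum_unique:
  assumes fin: "finite {t. f t \<noteq> 0}" and bnd: "\<And>t. \<bar>f t\<bar> \<le> \<bar>t\<bar>"
    and sum0: "(\<Sum>t | f t \<noteq> 0. of_int (f t) * weight t) = 0"
  shows "f t = 0"
proof (rule ccontr)
  assume "f t \<noteq> 0"
  let ?S = "{t. f t \<noteq> 0}"
  define m where "m = Min ?S"
  have mS: "m \<in> ?S" unfolding m_def by (rule Min_in) (use fin \<open>f t \<noteq> 0\<close> in auto)
  have "\<exists>c. weight u = weight m * of_int ((\<bar>m\<bar> + 1) * c)" if "u \<in> ?S - {m}" for u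
  proof (rule weight_dvd)
    have "m \<le> u" unfolding m_def by (rule Min_le) (use fin that in auto)
    with that show "m < u" by auto
  qed
  then obtain c where c: "\<And>u. u \<in> ?S - {m} \<Longrightarrow> weight u = weight m * of_int ((\<bar>m\<bar> + 1) * c u)"
    by metis
  have "0 = of_int (f m) * weight m + (\<Sum>u\<in>?S - {m}. of_int (f u) * weight u)"
    using sum0 sum.remove[OF fin mS, of "\<lambda>t. of_int (f t) * weight t"] by simp
  also have "(\<Sum>u\<in>?S - {m}. of_int (f u) * weight u)
    = (\<Sum>u\<in>?S - {m}. weight m * of_int ((\<bar>m\<bar> + 1) * (f u * c u)))"
    by (rule sum.cong) (simp_all add: c)
  also have "\<dots> = weight m * of_int ((\<bar>m\<bar> + 1) * (\<Sum>u\<in>?S - {m}. f u * c u))"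
    by (simp only: sum_distrib_left of_int_sum)
  finally have "weight m * of_int (f m + (\<bar>m\<bar> + 1) * (\<Sum>u\<in>?S - {m}. f u * c u)) = 0"
    by (simp add: algebra_simps)
  then have "f m + (\<bar>m\<bar> + 1) * (\<Sum>u\<in>?S - {m}. f u * c u) = 0"
    using weight_nonzero[of m] by (simp only: mult_eq_0_iff of_int_eq_0_iff simp_thms)
  then have "(\<bar>m\<bar> + 1) dvd f m" by (metis add_eq_0_iff dvd_minus_iff dvd_triv_left)
  with mS have "\<bar>m\<bar> + 1 \<le> \<bar>f m\<bar>" using dvd_imp_le_int[of "f m" "\<bar>m\<bar> + 1"] by auto
  with bnd[of m] show False by simp
qed

lemma is_expansion_unique:
  assumes "is_expansion q d" "is_expansion q e"
  shows "d = e"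
proof
  fix t
  let ?f = "\<lambda>t. d t - e t"
  from assms have d: "finite {t. d t \<noteq> 0}" "\<And>t. 0 \<le> d t \<and> d t \<le> \<bar>t\<bar>"
      "q = (\<Sum>t | d t \<noteq> 0. of_int (d t) * weight t)"
    and e: "finite {t. e t \<noteq> 0}" "\<And>t. 0 \<le> e t \<and> e t \<le> \<bar>t\<bar>"
      "q = (\<Sum>t | e t \<noteq> 0. of_int (e t) * weight t)"
    unfolding is_expansion_weight by blast+
  let ?U = "{t. d t \<noteq> 0} \<union> {t. e t \<noteq> 0}"
  have U: "finite ?U" using d e by simp
  have sub: "{t. ?f t \<noteq> 0} \<subseteq> ?U" by auto
  have "?f t = 0"
  proof (rule weighted_sum_unique[of ?f])
    show "finite {t. ?f t \<noteq> 0}" by (rule finite_subset[OF sub U])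
    show "\<bar>?f t\<bar> \<le> \<bar>t\<bar>" for t using d(2)[of t] e(2)[of t] by linarith
    have "(\<Sum>t | ?f t \<noteq> 0. of_int (?f t) * weight t) = (\<Sum>t\<in>?U. of_int (?f t) * weight t)"
      by (rule sum.mono_neutral_left[OF U sub]) auto
    also have "\<dots> = (\<Sum>t\<in>?U. of_int (d t) * weight t) - (\<Sum>t\<in>?U. of_int (e t) * weight t)"
      by (simp add: algebra_simps sum_subtractf)
    also have "(\<Sum>t\<in>?U. of_int (d t) * weight t) = q"
      unfolding d(3) by (rule sum.mono_neutral_right[OF U]) auto
    also have "(\<Sum>t\<in>?U. of_int (e t) * weight t) = q"
      unfolding e(3) by (rule sum.mono_neutral_right[OF U]) auto
    finally show "(\<Sum>t | ?f t \<noteq> 0. of_int (?f t) * weight t) = 0" by simp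
  qed
  then show "d t = e t" by simp
qed

definition expands_from :: "int \<Rightarrow> rat \<Rightarrow> bool" where
  "expands_from b q \<longleftrightarrow> (\<exists>d. is_expansion q d \<and> (\<forall>t < b. d t = 0))"

lemma expands_from_step:
  assumes "t \<noteq> 0"
    and next_digit: "expands_from (t + 1) (weight (t + 1) * of_int ((if t = -1 then 1 else -1) * (m div (\<bar>t\<bar> + 1))))"
  shows "expands_from t (weight t * of_int m)"
proof -
  let ?a = "m mod (\<bar>t\<bar> + 1)"
  let ?q = "weight (t + 1) * of_int ((if t = -1 then 1 else -1) * (m div (\<bar>t\<bar> + 1)))"
  from next_digit obtain e where e: "finite {u. e u \<noteq> 0}" "\<And>u. 0 \<le> e u \<and> e u \<le> \<bar>u\<bar>"
      "?q = (\<Sum>u | e u \<noteq> 0. of_int (e u) * weight u)" "\<And>u. u < t + 1 \<Longrightarrow> e u = 0"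
    unfolding expands_from_def is_expansion_weight by blast
  let ?d = "e(t := ?a)"
  have et: "e t = 0" using e(4) by simp
  have a: "0 \<le> ?a" "?a \<le> \<bar>t\<bar>"
    using pos_mod_sign[of "\<bar>t\<bar> + 1" m] pos_mod_bound[of "\<bar>t\<bar> + 1" m] by linarith+
  have sub: "{u. ?d u \<noteq> 0} \<subseteq> insert t {u. e u \<noteq> 0}" by auto
  have fin: "finite {u. ?d u \<noteq> 0}" by (rule finite_subset[OF sub]) (simp add: e(1))
  have "m = ?a + (\<bar>t\<bar> + 1) * (m div (\<bar>t\<bar> + 1))" by simp
  then have "weight t * of_int m
      = weight t * of_int ?a + weight t * of_int ((\<bar>t\<bar> + 1) * (m div (\<bar>t\<bar> + 1)))"
    by (metis distrib_left of_int_add)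
  also have "\<dots> = of_int ?a * weight t + ?q"
    by (simp add: weight_step)
  also have "?q = (\<Sum>u | e u \<noteq> 0. of_int (?d u) * weight u)"
    unfolding e(3) by (rule sum.cong) (use et in auto)
  also have "of_int ?a * weight t + \<dots> = (\<Sum>u\<in>insert t {u. e u \<noteq> 0}. of_int (?d u) * weight u)"
    using e(1) et by simp
  also have "\<dots> = (\<Sum>u | ?d u \<noteq> 0. of_int (?d u) * weight u)"
    by (rule sum.mono_neutral_right) (use e(1) sub in auto)
  finally have "is_expansion (weight t * of_int m) ?d"
    unfolding is_expansion_weight using fin e(2) a by simp
  moreover have "\<forall>u < t. ?d u = 0" using e(4) by simp
  ultimately show ?thesis unfolding expands_from_def by blast
qed

lemma expands_from_zero: "expands_from t 0"
  unfolding expands_from_def is_expansion_weight by (rule exI[of _ "\<lambda>_. 0"]) simp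

lemma expands_from_int:
  "r \<ge> 1 \<Longrightarrow> expands_from r (weight r * of_int m)"
proof (induction "nat (2 * \<bar>m\<bar> + (if m < 0 then 1 else 0))" arbitrary: r m rule: less_induct)
  case less
  show ?case
  proof (cases "m = 0")
    case True
    then show ?thesis by (simp add: expands_from_zero)
  next
    case False
    let ?k = "m div (r + 1)"
    have m: "m = (r + 1) * ?k + m mod (r + 1)" by simp
    have b: "0 \<le> m mod (r + 1)" "m mod (r + 1) < r + 1"
      using less.prems pos_mod_sign[of "r + 1" m] pos_mod_bound[of "r + 1" m] by linarith+
    have "nat (2 * \<bar>-?k\<bar> + (if -?k < 0 then 1 else 0)) < nat (2 * \<bar>m\<bar> + (if m < 0 then 1 else 0))"
    proof (cases "m > 0")
      case True
      have "0 \<le> ?k" using True less.prems by (simp add: pos_imp_zdiv_nonneg_iff)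
      moreover have "?k < m" using True less.prems by (intro int_div_less_self) auto
      ultimately show ?thesis using True by auto
    next
      case neg: False
      with False have "m < 0" by simp
      then have k: "?k < 0" using less.prems by (simp add: neg_imp_zdiv_neg_iff pos_imp_zdiv_neg_iff)
      have "r * (- ?k - 1) \<ge> 1 * (- ?k - 1)" by (rule mult_right_mono) (use k less.prems in auto)
      then have "- ?k \<le> - m" using m b k by (simp add: algebra_simps)
      with k \<open>m < 0\<close> show ?thesis by auto
    qed
    then have "expands_from (r + 1) (weight (r + 1) * of_int (- ?k))"
      by (rule less.hyps) (use less.prems in simp)
    moreover have "r \<noteq> 0" "r \<noteq> -1" "\<bar>r\<bar> = r" using less.prems by auto
    ultimately show ?thesis using expands_from_step[of r m] by simp
  qed
qed

lemma expands_from_frac: "expands_from (- int n) (weight (- int n) * of_int m)"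
proof (induction n arbitrary: m)
  case 0
  have "expands_from 1 (weight 1 * of_int (- m))" by (rule expands_from_int) simp
  then obtain d where d: "is_expansion (weight 1 * of_int (- m)) d" "\<forall>t < 1. d t = 0"
    unfolding expands_from_def by blast
  then show ?case unfolding expands_from_def by (intro exI[of _ d]) (simp add: weight_def)
next
  case (Suc n)
  have "- int (Suc n) + 1 = - int n" by simp
  then show ?case by (intro expands_from_step[of "- int (Suc n)" m]) (simp, simp only: Suc.IH)
qed

lemma ex1_is_expansion: "\<exists>!d. is_expansion q d"
proof (rule ex_ex1I)
  obtain a b where q: "q = of_int a / of_int b" and "b > 0"
    by (metis quotient_of_div quotient_of_denom_pos surj_pair)
  define n where "n = nat b"
  have n: "of_int b = (of_nat n :: rat)" "n \<ge> 1" using \<open>b > 0\<close> by (auto simp: n_def)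
  have "n dvd fact (n + 1)" using n by (intro dvd_fact) auto
  then obtain c where c: "fact (n + 1) = n * c" by (rule dvdE)
  have f: "fact (n + 1) = (of_nat n * of_nat c :: rat)"
    using arg_cong[OF c, of "of_nat :: nat \<Rightarrow> rat"] by (simp only: of_nat_fact of_nat_mult)
  then have "c \<noteq> 0" using fact_nonzero[of "n + 1", where 'a = rat] by auto
  have "weight (- int n) = (-1) ^ n / fact (n + 1)" using n by (simp add: weight_def)
  then have "weight (- int n) = (-1) ^ n / (of_nat n * of_nat c)" using f by simp
  then have "weight (- int n) * of_int ((-1) ^ n * a * int c)
      = ((-1) ^ n * (-1) ^ n) * (of_int a * of_nat c) / (of_nat n * of_nat c)" by simp
  also have "\<dots> = q"
    using q n \<open>c \<noteq> 0\<close> by (simp flip: power_mult_distrib)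
  finally have "weight (- int n) * of_int ((-1) ^ n * a * int c) = q" .
  then show "\<exists>d. is_expansion q d"
    using expands_from_frac[of n "(-1) ^ n * a * int c"] unfolding expands_from_def by auto
qed (rule is_expansion_unique)

end

theory Submission
  imports Defs "HOL-Library.Countable"
begin

text \<open>The theorem follows from an IP version of van der Waerden's theorem in an abelian group: for
  finitely many sequences \<open>x a\<close> and every finite colouring there are \<open>\<alpha>\<close> and a non-empty finite index
  set \<open>A\<close> such that the points \<open>\<alpha> + (\<Sum>i\<in>A. x a i)\<close> all have one colour. It is
  applied to \<open>x (p, q, f) i = (p * weight (- i) + q * weight i) *s f\<close>: then \<open>\<beta>\<close> and \<open>\<gamma>\<close> are the sums
  of the weights at \<open>-A\<close> and \<open>A\<close>, so their digits can be read off, and starting the indices late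
  enough places the domains beyond \<open>k1\<close> and \<open>k2\<close>.
  The IP theorem is proved by induction on the number of sequences, by colour focusing.\<close>

section \<open>Monochromatic IP configurations\<close>

text \<open>The sets \<open>D\<close> and \<open>{m..<n}\<close> are independent of the colouring: focusing applies the
  property to colourings by the colour patterns of a finite window, which must be known beforehand.\<close>

definition ip_regular :: "('e \<Rightarrow> nat \<Rightarrow> 'v::ab_group_add) \<Rightarrow> 'e set \<Rightarrow> bool" where
  "ip_regular x E \<longleftrightarrow> (\<forall>(C::nat set) m. finite C \<longrightarrow>
     (\<exists>D n. finite D \<and> (\<forall>\<kappa>. range \<kappa> \<subseteq> C \<longrightarrow>
        (\<exists>\<alpha>\<in>D. \<exists>A\<subseteq>{m..<n}. A \<noteq> {} \<and> (\<exists>c. \<forall>a\<in>E. \<kappa> (\<alpha> + (\<Sum>i\<in>A. x a i)) = c)))))"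

lemma ip_regularE:
  fixes C :: "nat set"
  assumes "ip_regular x E" "finite C"
  obtains D n where "finite D" "\<forall>\<kappa>. range \<kappa> \<subseteq> C \<longrightarrow>
       (\<exists>\<alpha>\<in>D. \<exists>A\<subseteq>{m..<n}. A \<noteq> {} \<and> (\<exists>c. \<forall>a\<in>E. \<kappa> (\<alpha> + (\<Sum>i\<in>A. x a i)) = c))"
  using assms(1)[unfolded ip_regular_def, rule_format, OF assms(2), of m]
  by (elim exE conjE) (rule that)

lemma ip_regular_singleton: "ip_regular x {a}"
  unfolding ip_regular_def
proof (intro allI impI)
  fix C :: "nat set" and m
  show "\<exists>D n. finite D \<and> (\<forall>\<kappa>. range \<kappa> \<subseteq> C \<longrightarrow>
        (\<exists>\<alpha>\<in>D. \<exists>A\<subseteq>{m..<n}. A \<noteq> {} \<and> (\<exists>c. \<forall>a\<in>{a}. \<kappa> (\<alpha> + (\<Sum>i\<in>A. x a i)) = c)))"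
    by (rule exI[of _ "{0}"], rule exI[of _ "Suc m"]) (auto intro!: exI[of _ "{m}"])
qed

section \<open>Colour focusing\<close>

text \<open>The new colour of \<open>v\<close> encodes the list of old colours on the translate
  \<open>v + W\<close>. Lists of fixed length over \<open>C\<close> are finite in number, so
  \<open>C'\<close> can be fixed before \<open>\<kappa>\<close> is known.\<close>

lemma window_colouring:
  fixes W :: "'v::ab_group_add set" and C :: "nat set"
  assumes "finite W" "finite C"
  obtains C' :: "nat set" and \<Phi> :: "('v \<Rightarrow> nat) \<Rightarrow> 'v \<Rightarrow> nat" where "finite C'"
    "\<forall>\<kappa>. range \<kappa> \<subseteq> C \<longrightarrow> range (\<Phi> \<kappa>) \<subseteq> C'"
    "\<forall>\<kappa> u v. \<Phi> \<kappa> u = \<Phi> \<kappa> v \<longrightarrow> (\<forall>w\<in>W. \<kappa> (u + w) = \<kappa> (v + w))"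
proof -
  obtain ws where ws: "set ws = W" using finite_list[OF assms(1)] by blast
  show thesis
  proof (rule that[of "to_nat ` {l. set l \<subseteq> C \<and> length l = length ws}"
        "\<lambda>\<kappa> v. to_nat (map (\<lambda>w. \<kappa> (v + w)) ws)"])
    show "finite (to_nat ` {l. set l \<subseteq> C \<and> length l = length ws})"
      using finite_lists_length_eq[OF assms(2)] by blast
    show "\<forall>\<kappa>. range \<kappa> \<subseteq> C \<longrightarrow> range (\<lambda>v. to_nat (map (\<lambda>w. \<kappa> (v + w)) ws))
        \<subseteq> to_nat ` {l. set l \<subseteq> C \<and> length l = length ws}"
      by (intro allI impI image_subsetI imageI) auto
  qed (simp add: ws)
qed

text \<open>Induction on \<open>j\<close>: unless some configuration already has the colour of its
  base point, differently coloured configurations accumulate at a common base point. Once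
  \<open>j\<close> reaches the number of colours, one of them must have the colour of the base point
  after all.\<close>

lemma colour_focusing:
  fixes x :: "'e \<Rightarrow> nat \<Rightarrow> 'v::ab_group_add" and C :: "nat set"
  assumes reg: "ip_regular x E" and E: "finite E" "E \<noteq> {}" and C: "finite C"
  shows "\<exists>D n. finite D \<and> (\<forall>\<kappa>. range \<kappa> \<subseteq> C \<longrightarrow> (\<exists>\<alpha>\<in>D.
      (\<exists>A\<subseteq>{m..<n}. A \<noteq> {} \<and> (\<forall>a\<in>E. \<kappa> (\<alpha> + (\<Sum>i\<in>A. x a i)) = \<kappa> \<alpha>)) \<or>
      (\<exists>K\<subseteq>C. card K = j \<and>
         (\<forall>c\<in>K. \<exists>A\<subseteq>{m..<n}. A \<noteq> {} \<and> (\<forall>a\<in>E. \<kappa> (\<alpha> + (\<Sum>i\<in>A. x a i)) = c)))))"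
proof (induction j)
  case 0
  show ?case by (rule exI[of _ "{0}"]) (auto intro!: exI[of _ "{}"])
next
  case (Suc j)
  then obtain D n where D: "finite D" and focus: "\<And>\<kappa>. range \<kappa> \<subseteq> C \<Longrightarrow> \<exists>\<alpha>\<in>D.
      (\<exists>A\<subseteq>{m..<n}. A \<noteq> {} \<and> (\<forall>a\<in>E. \<kappa> (\<alpha> + (\<Sum>i\<in>A. x a i)) = \<kappa> \<alpha>)) \<or>
      (\<exists>K\<subseteq>C. card K = j \<and>
         (\<forall>c\<in>K. \<exists>A\<subseteq>{m..<n}. A \<noteq> {} \<and> (\<forall>a\<in>E. \<kappa> (\<alpha> + (\<Sum>i\<in>A. x a i)) = c)))"
    by blast
  \<comment> \<open>The window holds every point at which the pattern \<open>\<psi>\<close> below is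
    evaluated: the base points in \<open>D\<close> and the points of all configurations based
    there.\<close>
  define W where "W = D \<union> (\<lambda>(\<alpha>, a, B). \<alpha> + (\<Sum>i\<in>B. x a i)) ` (D \<times> E \<times> Pow {m..<n})"
  have "finite W" using D E by (simp add: W_def)
  have WD: "\<alpha> \<in> W" if "\<alpha> \<in> D" for \<alpha> using that by (simp add: W_def)
  have WS: "\<alpha> + (\<Sum>i\<in>B. x a i) \<in> W" if "\<alpha> \<in> D" "a \<in> E" "B \<subseteq> {m..<n}" for \<alpha> a B
    using that unfolding W_def by (intro UnI2 image_eqI[of _ _ "(\<alpha>, a, B)"]) auto
  obtain C' and \<Phi> :: "('v \<Rightarrow> nat) \<Rightarrow> 'v \<Rightarrow> nat" where C': "finite C'"
    and ran: "\<forall>\<kappa>. range \<kappa> \<subseteq> C \<longrightarrow> range (\<Phi> \<kappa>) \<subseteq> C'"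
    and window: "\<forall>\<kappa> u v. \<Phi> \<kappa> u = \<Phi> \<kappa> v \<longrightarrow> (\<forall>w\<in>W. \<kappa> (u + w) = \<kappa> (v + w))"
    by (rule window_colouring[OF \<open>finite W\<close> C])
  \<comment> \<open>Starting the new indices at \<open>max m n\<close> keeps them disjoint from the
    old ones in \<open>{m..<n}\<close>, so that sums over \<open>A\<close> and \<open>B\<close> add
    up to a sum over \<open>A \<union> B\<close>; the \<open>max\<close> preserves the lower bound
    \<open>m\<close> even if \<open>n < m\<close>.\<close>
  obtain D' n' where D': "finite D'" and mono: "\<forall>\<kappa>. range \<kappa> \<subseteq> C' \<longrightarrow>
       (\<exists>\<alpha>\<in>D'. \<exists>A\<subseteq>{max m n..<n'}. A \<noteq> {} \<and> (\<exists>c. \<forall>a\<in>E. \<kappa> (\<alpha> + (\<Sum>i\<in>A. x a i)) = c))"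
    by (rule ip_regularE[OF reg C'])
  obtain a0 where a0: "a0 \<in> E" using E by blast
  define G where "G = (\<lambda>(\<beta>, \<alpha>). \<beta> + \<alpha>) ` (D' \<times> D)
    \<union> (\<lambda>(\<beta>, A, \<alpha>). \<beta> + (\<Sum>i\<in>A. x a0 i) + \<alpha>) ` (D' \<times> Pow {max m n..<n'} \<times> D)"
  have "finite G" using D D' by (simp add: G_def)
  have G1: "\<beta> + \<alpha> \<in> G" if "\<beta> \<in> D'" "\<alpha> \<in> D" for \<beta> \<alpha>
    using that unfolding G_def by (intro UnI1 image_eqI[of _ _ "(\<beta>, \<alpha>)"]) auto
  have G2: "\<beta> + (\<Sum>i\<in>A. x a0 i) + \<alpha> \<in> G" if "\<beta> \<in> D'" "A \<subseteq> {max m n..<n'}" "\<alpha> \<in> D" for \<beta> A \<alpha>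
    using that unfolding G_def by (intro UnI2 image_eqI[of _ _ "(\<beta>, A, \<alpha>)"]) auto
  show ?case
  proof (intro exI[of _ G] exI[of _ "max n n'"] conjI allI impI \<open>finite G\<close>)
    fix \<kappa> :: "'v \<Rightarrow> nat"
    assume \<kappa>: "range \<kappa> \<subseteq> C"
    obtain \<beta> A c0 where \<beta>: "\<beta> \<in> D'" and A: "A \<subseteq> {max m n..<n'}" "A \<noteq> {}"
      and c0: "\<And>a. a \<in> E \<Longrightarrow> \<Phi> \<kappa> (\<beta> + (\<Sum>i\<in>A. x a i)) = c0"
      using mono[rule_format, OF ran[rule_format, OF \<kappa>]] by blast
    have A_sub: "A \<subseteq> {m..<max n n'}" using A(1) by (rule subset_trans) auto
    \<comment> \<open>The translates of the window to
      \<open>\<beta> + (\<Sum>i\<in>A. x a i)\<close> are coloured alike for all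
      \<open>a \<in> E\<close>. \<open>\<psi>\<close> is this common pattern, read off at the
      arbitrary representative \<open>a0\<close>; the induction hypothesis is applied to it.\<close>
    define \<psi> where "\<psi> v = \<kappa> (\<beta> + (\<Sum>i\<in>A. x a0 i) + v)" for v
    have \<psi>: "\<kappa> (\<beta> + (\<Sum>i\<in>A. x a i) + w) = \<psi> w" if "a \<in> E" "w \<in> W" for a w
      unfolding \<psi>_def by (rule window[rule_format]) (simp_all add: c0 a0 that)
    have "range \<psi> \<subseteq> C" using \<kappa> by (auto simp: \<psi>_def)
    from focus[OF this] obtain \<alpha> where \<alpha>: "\<alpha> \<in> D" and alt:
      "(\<exists>A\<subseteq>{m..<n}. A \<noteq> {} \<and> (\<forall>a\<in>E. \<psi> (\<alpha> + (\<Sum>i\<in>A. x a i)) = \<psi> \<alpha>)) \<or>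
       (\<exists>K\<subseteq>C. card K = j \<and>
         (\<forall>c\<in>K. \<exists>A\<subseteq>{m..<n}. A \<noteq> {} \<and> (\<forall>a\<in>E. \<psi> (\<alpha> + (\<Sum>i\<in>A. x a i)) = c)))"
      by blast
    show "\<exists>\<alpha>\<in>G.
      (\<exists>A\<subseteq>{m..<max n n'}. A \<noteq> {} \<and> (\<forall>a\<in>E. \<kappa> (\<alpha> + (\<Sum>i\<in>A. x a i)) = \<kappa> \<alpha>)) \<or>
      (\<exists>K\<subseteq>C. card K = Suc j \<and>
         (\<forall>c\<in>K. \<exists>A\<subseteq>{m..<max n n'}. A \<noteq> {} \<and> (\<forall>a\<in>E. \<kappa> (\<alpha> + (\<Sum>i\<in>A. x a i)) = c)))"
    proof (cases "\<exists>B\<subseteq>{m..<n}. B \<noteq> {} \<and> (\<forall>a\<in>E. \<psi> (\<alpha> + (\<Sum>i\<in>B. x a i)) = \<psi> \<alpha>)")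
      case True
      then obtain B where B: "B \<subseteq> {m..<n}" "B \<noteq> {}"
        and eq: "\<And>a. a \<in> E \<Longrightarrow> \<psi> (\<alpha> + (\<Sum>i\<in>B. x a i)) = \<psi> \<alpha>" by blast
      have "B \<subseteq> {m..<max n n'}" using B(1) by (rule subset_trans) auto
      moreover have "\<forall>a\<in>E. \<kappa> (\<beta> + (\<Sum>i\<in>A. x a0 i) + \<alpha> + (\<Sum>i\<in>B. x a i))
          = \<kappa> (\<beta> + (\<Sum>i\<in>A. x a0 i) + \<alpha>)"
        using eq by (simp add: \<psi>_def add.assoc)
      ultimately show ?thesis
        by (intro bexI[OF _ G2[OF \<beta> A(1) \<alpha>]] disjI1 exI[of _ B] conjI B(2))
    next
      case False
      with alt obtain K where K: "K \<subseteq> C" "card K = j" and KB: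
        "\<And>c. c \<in> K \<Longrightarrow> \<exists>B\<subseteq>{m..<n}. B \<noteq> {} \<and> (\<forall>a\<in>E. \<psi> (\<alpha> + (\<Sum>i\<in>B. x a i)) = c)"
        by blast
      \<comment> \<open>A configuration of colour \<open>\<psi> \<alpha>\<close> would be the first
        alternative, which is excluded here. Hence this colour is new.\<close>
      have "\<psi> \<alpha> \<notin> K" using KB False by blast
      moreover have "finite K" using K C finite_subset by blast
      ultimately have "card (insert (\<psi> \<alpha>) K) = Suc j" using K by simp
      moreover have "insert (\<psi> \<alpha>) K \<subseteq> C" using K \<open>range \<psi> \<subseteq> C\<close> by auto
      moreover have "\<exists>B\<subseteq>{m..<max n n'}. B \<noteq> {} \<and> (\<forall>a\<in>E. \<kappa> (\<beta> + \<alpha> + (\<Sum>i\<in>B. x a i)) = c)"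
        if c: "c \<in> insert (\<psi> \<alpha>) K" for c
      proof -
        from c consider "c = \<psi> \<alpha>" | "c \<in> K" by blast
        then show ?thesis
        proof cases
          case 1
          \<comment> \<open>The set \<open>A\<close> alone supplies the new colour: its points are
            the copies of \<open>\<alpha>\<close> in the translated windows.\<close>
          have "\<forall>a\<in>E. \<kappa> (\<beta> + \<alpha> + (\<Sum>i\<in>A. x a i)) = c"
          proof
            fix a assume "a \<in> E"
            have "\<beta> + \<alpha> + (\<Sum>i\<in>A. x a i) = \<beta> + (\<Sum>i\<in>A. x a i) + \<alpha>"
              by (simp only: ac_simps)
            then show "\<kappa> (\<beta> + \<alpha> + (\<Sum>i\<in>A. x a i)) = c"
              using 1 \<psi>[OF \<open>a \<in> E\<close> WD[OF \<alpha>]] by (simp only:)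
          qed
          with A_sub A(2) show ?thesis by blast
        next
          case 2
          from KB[OF this] obtain B where B: "B \<subseteq> {m..<n}" "B \<noteq> {}"
            and Bc: "\<forall>a\<in>E. \<psi> (\<alpha> + (\<Sum>i\<in>B. x a i)) = c" by blast
          have fin: "finite A" "finite B" using A(1) B(1) finite_subset by blast+
          have "{max m n..<n'} \<inter> {m..<n} = {}" by auto
          then have disj: "A \<inter> B = {}" using A(1) B(1) by blast
          \<comment> \<open>An old configuration keeps its colour when \<open>A\<close> is adjoined
            to its index set, which moves each of its points into the translated window belonging to
            the same \<open>a\<close>.\<close>
          have "\<forall>a\<in>E. \<kappa> (\<beta> + \<alpha> + (\<Sum>i\<in>A \<union> B. x a i)) = c"
          proof
            fix a assume "a \<in> E"
            have eq: "\<beta> + \<alpha> + (\<Sum>i\<in>A \<union> B. x a i) = \<beta> + (\<Sum>i\<in>A. x a i) + (\<alpha> + (\<Sum>i\<in>B. x a i))"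
              by (simp only: sum.union_disjoint[OF fin disj] ac_simps)
            show "\<kappa> (\<beta> + \<alpha> + (\<Sum>i\<in>A \<union> B. x a i)) = c"
              unfolding eq \<psi>[OF \<open>a \<in> E\<close> WS[OF \<alpha> \<open>a \<in> E\<close> B(1)]]
              using Bc \<open>a \<in> E\<close> by blast
          qed
          moreover have "B \<subseteq> {m..<max n n'}" using B(1) by (rule subset_trans) auto
          then have "A \<union> B \<subseteq> {m..<max n n'}" using A_sub by (rule Un_least[rotated])
          moreover have "A \<union> B \<noteq> {}" using B(2) by blast
          ultimately show ?thesis by blast
        qed
      qed
      ultimately have "\<exists>K\<subseteq>C. card K = Suc j \<and> (\<forall>c\<in>K.
          \<exists>B\<subseteq>{m..<max n n'}. B \<noteq> {} \<and> (\<forall>a\<in>E. \<kappa> (\<beta> + \<alpha> + (\<Sum>i\<in>B. x a i)) = c))"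
        by (meson ballI)
      then show ?thesis by (intro bexI[OF _ G1[OF \<beta> \<alpha>]] disjI2)
    qed
  qed
qed

section \<open>Induction on the number of sequences\<close>

text \<open>Subtracting the sequence of \<open>e\<close> turns its point into the base point.
  Focusing for the differences gives a configuration coloured like its base point
  \<open>\<alpha>\<close>; translating the base point by \<open>- (\<Sum>i\<in>A. x e i)\<close>
  restores the original sequences, with \<open>\<alpha>\<close> as the point of
  \<open>e\<close>.\<close>

lemma ip_regular_insert:
  fixes x :: "'e \<Rightarrow> nat \<Rightarrow> 'v::ab_group_add"
  assumes reg: "ip_regular (\<lambda>a i. x a i - x e i) E" and E: "finite E" "E \<noteq> {}"
  shows "ip_regular x (insert e E)"
  unfolding ip_regular_def
proof (intro allI impI)
  fix C :: "nat set" and m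
  assume C: "finite C"
  let ?y = "\<lambda>a i. x a i - x e i"
  from colour_focusing[OF reg E C, of m "card C"]
  obtain D n where D: "finite D" and focus: "\<forall>\<kappa>. range \<kappa> \<subseteq> C \<longrightarrow> (\<exists>\<alpha>\<in>D.
      (\<exists>A\<subseteq>{m..<n}. A \<noteq> {} \<and> (\<forall>a\<in>E. \<kappa> (\<alpha> + (\<Sum>i\<in>A. ?y a i)) = \<kappa> \<alpha>)) \<or>
      (\<exists>K\<subseteq>C. card K = card C \<and>
         (\<forall>c\<in>K. \<exists>A\<subseteq>{m..<n}. A \<noteq> {} \<and> (\<forall>a\<in>E. \<kappa> (\<alpha> + (\<Sum>i\<in>A. ?y a i)) = c))))"
    by (elim exE conjE)
  define G where "G = (\<lambda>(\<alpha>, A). \<alpha> - (\<Sum>i\<in>A. x e i)) ` (D \<times> Pow {m..<n})"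
  have "finite G" using D by (simp add: G_def)
  moreover have "\<exists>\<alpha>\<in>G. \<exists>A\<subseteq>{m..<n}. A \<noteq> {} \<and> (\<exists>c. \<forall>a\<in>insert e E. \<kappa> (\<alpha> + (\<Sum>i\<in>A. x a i)) = c)"
    if \<kappa>: "range \<kappa> \<subseteq> C" for \<kappa>
  proof -
    obtain \<alpha> A where \<alpha>: "\<alpha> \<in> D" and A: "A \<subseteq> {m..<n}" "A \<noteq> {}"
      and eq: "\<And>a. a \<in> E \<Longrightarrow> \<kappa> (\<alpha> + (\<Sum>i\<in>A. ?y a i)) = \<kappa> \<alpha>"
    proof -
      from focus[rule_format, OF \<kappa>] obtain \<alpha> where \<alpha>: "\<alpha> \<in> D" and alt:
        "(\<exists>A\<subseteq>{m..<n}. A \<noteq> {} \<and> (\<forall>a\<in>E. \<kappa> (\<alpha> + (\<Sum>i\<in>A. ?y a i)) = \<kappa> \<alpha>)) \<or>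
         (\<exists>K\<subseteq>C. card K = card C \<and>
           (\<forall>c\<in>K. \<exists>A\<subseteq>{m..<n}. A \<noteq> {} \<and> (\<forall>a\<in>E. \<kappa> (\<alpha> + (\<Sum>i\<in>A. ?y a i)) = c)))"
        by blast
      \<comment> \<open>With as many focused colours as there are colours,
        \<open>\<kappa> \<alpha>\<close> is among them, so the second alternative also yields the
        first.\<close>
      have "K = C" if "K \<subseteq> C" "card K = card C" for K using that C by (simp add: card_subset_eq)
      moreover have "\<kappa> \<alpha> \<in> C" using \<kappa> by auto
      ultimately have "\<exists>A\<subseteq>{m..<n}. A \<noteq> {} \<and> (\<forall>a\<in>E. \<kappa> (\<alpha> + (\<Sum>i\<in>A. ?y a i)) = \<kappa> \<alpha>)"
        using alt by metis
      with \<alpha> that show thesis by blast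
    qed
    let ?\<alpha> = "\<alpha> - (\<Sum>i\<in>A. x e i)"
    have shift: "?\<alpha> + (\<Sum>i\<in>A. x a i) = \<alpha> + (\<Sum>i\<in>A. ?y a i)" for a
      by (simp add: sum_subtractf)
    have "\<kappa> (?\<alpha> + (\<Sum>i\<in>A. x e i)) = \<kappa> \<alpha>" by simp
    moreover have "\<forall>a\<in>E. \<kappa> (?\<alpha> + (\<Sum>i\<in>A. x a i)) = \<kappa> \<alpha>"
      unfolding shift using eq by blast
    ultimately have "\<forall>a\<in>insert e E. \<kappa> (?\<alpha> + (\<Sum>i\<in>A. x a i)) = \<kappa> \<alpha>" by blast
    moreover have "?\<alpha> \<in> G"
      unfolding G_def using \<alpha> A by (intro image_eqI[of _ _ "(\<alpha>, A)"]) auto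
    ultimately show ?thesis using A by blast
  qed
  ultimately show "\<exists>D n. finite D \<and> (\<forall>\<kappa>. range \<kappa> \<subseteq> C \<longrightarrow> (\<exists>\<alpha>\<in>D. \<exists>A\<subseteq>{m..<n}. A \<noteq> {} \<and>
      (\<exists>c. \<forall>a\<in>insert e E. \<kappa> (\<alpha> + (\<Sum>i\<in>A. x a i)) = c)))"
    by (intro exI[of _ G] exI[of _ n] conjI allI impI)
qed

lemma ip_regular_finite:
  assumes "finite E" "E \<noteq> {}"
  shows "ip_regular x E"
  using assms
\<comment> \<open>The sequences are generalised because the insertion step passes to their
  differences.\<close>
proof (induction E arbitrary: x rule: finite_ne_induct)
  case (singleton e)
  show ?case by (rule ip_regular_singleton)
next
  case (insert e E)
  then show ?case by (intro ip_regular_insert)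
qed

theorem ip_van_der_Waerden:
  fixes x :: "'e \<Rightarrow> nat \<Rightarrow> 'v::ab_group_add" and \<kappa> :: "'v \<Rightarrow> nat"
  assumes "finite E" "E \<noteq> {}" "finite (range \<kappa>)"
  obtains \<alpha> A c where "finite A" "A \<noteq> {}" "A \<subseteq> {m..}"
    "\<forall>a\<in>E. \<kappa> (\<alpha> + (\<Sum>i\<in>A. x a i)) = c"
proof -
  obtain D n where "finite D" "\<forall>\<kappa>'. range \<kappa>' \<subseteq> range \<kappa> \<longrightarrow>
       (\<exists>\<alpha>\<in>D. \<exists>A\<subseteq>{m..<n}. A \<noteq> {} \<and> (\<exists>c. \<forall>a\<in>E. \<kappa>' (\<alpha> + (\<Sum>i\<in>A. x a i)) = c))"
    by (rule ip_regularE[OF ip_regular_finite[OF assms(1,2)] assms(3)])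
  from this(2)[rule_format, OF order_refl] obtain \<alpha> A c where A: "A \<subseteq> {m..<n}" "A \<noteq> {}"
    and c: "\<forall>a\<in>E. \<kappa> (\<alpha> + (\<Sum>i\<in>A. x a i)) = c"
    by blast
  moreover have "finite A" using A(1) finite_subset by blast
  moreover have "A \<subseteq> {m..}" using A(1) by auto
  ultimately show thesis using that by blast
qed

section \<open>Domains of rationals\<close>

lemma rat_dom_eq:
  assumes "is_expansion q d"
  shows "rat_dom q = {t. d t \<noteq> 0}"
proof -
  have "rat_digits q = d"
    unfolding rat_digits_def using assms is_expansion_unique by blast
  moreover have "d 0 = 0" using assms by (simp add: is_expansion_def)
  ultimately show ?thesis unfolding rat_dom_def by auto
qed

text \<open>The digit 1 is admissible at every nonzero position, so a sum of distinct weights is its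
  own expansion.\<close>

lemma rat_dom_sum_weight:
  assumes "finite T" "0 \<notin> T"
  shows "rat_dom (\<Sum>t\<in>T. weight t) = T"
proof -
  let ?d = "\<lambda>t. if t \<in> T then 1 else 0 :: int"
  have T: "{t. ?d t \<noteq> 0} = T" by auto
  have "1 \<le> \<bar>t\<bar>" if "t \<in> T" for t
  proof -
    have "t \<noteq> 0" using that assms(2) by blast
    then show ?thesis by linarith
  qed
  then have "is_expansion (\<Sum>t\<in>T. weight t) ?d"
    unfolding is_expansion_weight T using assms(1) by simp
  from rat_dom_eq[OF this] T show ?thesis by simp
qed

text \<open>Since \<open>weight 1\<close> is 1, an integer can be expanded from position 1 upwards;
  by uniqueness this is its only expansion. The contrapositive is what shows
  \<open>\<beta> \<notin> \<int>\<close>.\<close>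

lemma rat_dom_neg_Ints:
  assumes "q \<in> \<int>"
  shows "rat_dom_neg q = {}"
proof -
  from assms obtain n where "q = weight 1 * of_int n"
    by (auto elim!: Ints_cases simp: weight_def)
  then obtain d where "is_expansion q d" "\<forall>t<1. d t = 0"
    using expands_from_int[of 1 n] unfolding expands_from_def by auto
  then show ?thesis
    unfolding rat_dom_neg_def by (auto simp: rat_dom_eq)
qed

lemma rat_dom_zero: "rat_dom 0 = {}"
  using rat_dom_sum_weight[of "{}"] by simp

lemma weight_Ints: "t \<ge> 0 \<Longrightarrow> weight t \<in> \<int>"
  by (auto simp: weight_def fact_in_Ints intro!: Ints_mult Ints_power)

text \<open>The domain of \<open>\<beta>\<close> is the negative of \<open>A\<close>. It is
  non-empty, so \<open>\<beta>\<close> is not an integer and the maximum is attained; its elements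
  are at most \<open>- m\<close>, hence below \<open>k\<close>.\<close>

lemma sum_weight_neg:
  fixes k :: real
  assumes A: "finite A" "A \<noteq> {}" "A \<subseteq> {m..}" and m: "m \<ge> 1" "- k < real m"
  defines "\<beta> \<equiv> \<Sum>i\<in>A. weight (- int i)"
  shows "\<beta> \<notin> \<int>" "rat_dom_pos \<beta> = {}" "real_of_int (Max (rat_dom_neg \<beta>)) < k"
proof -
  let ?T = "(\<lambda>i. - int i) ` A"
  have T: "finite ?T" "?T \<noteq> {}" "\<And>t. t \<in> ?T \<Longrightarrow> t < 0" "\<And>t. t \<in> ?T \<Longrightarrow> real_of_int t < k"
    using A m by fastforce+
  have "\<beta> = (\<Sum>t\<in>?T. weight t)"
    unfolding \<beta>_def by (simp add: sum.reindex inj_on_def)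
  then have dom: "rat_dom \<beta> = ?T"
    using rat_dom_sum_weight[OF T(1)] T(3) by force
  have neg: "rat_dom_neg \<beta> = ?T" unfolding rat_dom_neg_def dom using T(3) by blast
  show "\<beta> \<notin> \<int>" using rat_dom_neg_Ints neg T(2) by metis
  show "rat_dom_pos \<beta> = {}" unfolding rat_dom_pos_def dom using T(3) by force
  show "real_of_int (Max (rat_dom_neg \<beta>)) < k"
    unfolding neg by (rule T(4)) (rule Max_in[OF T(1,2)])
qed

lemma sum_weight_pos:
  fixes k :: real
  assumes A: "finite A" "A \<noteq> {}" "A \<subseteq> {m..}" and m: "m \<ge> 1" "k < real m"
  defines "\<gamma> \<equiv> \<Sum>i\<in>A. weight (int i)"
  shows "\<gamma> \<in> \<int> - {0}" "rat_dom_neg \<gamma> = {}" "k < real_of_int (Min (rat_dom_pos \<gamma>))"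
proof -
  let ?T = "int ` A"
  have T: "finite ?T" "?T \<noteq> {}" "\<And>t. t \<in> ?T \<Longrightarrow> t > 0" "\<And>t. t \<in> ?T \<Longrightarrow> k < real_of_int t"
    using A m by fastforce+
  have "\<gamma> = (\<Sum>t\<in>?T. weight t)"
    unfolding \<gamma>_def by (simp add: sum.reindex inj_on_def)
  then have dom: "rat_dom \<gamma> = ?T"
    using rat_dom_sum_weight[OF T(1)] T(3) by force
  have pos: "rat_dom_pos \<gamma> = ?T" unfolding rat_dom_pos_def dom using T(3) by blast
  have "\<gamma> \<in> \<int>" unfolding \<gamma>_def by (intro Ints_sum weight_Ints) simp
  moreover have "\<gamma> \<noteq> 0" using rat_dom_zero dom T(2) by metis
  ultimately show "\<gamma> \<in> \<int> - {0}" by simp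
  show "rat_dom_neg \<gamma> = {}" unfolding rat_dom_neg_def dom using T(3) by force
  show "k < real_of_int (Min (rat_dom_pos \<gamma>))"
    unfolding pos by (rule T(4)) (rule Min_in[OF T(1,2)])
qed

section \<open>The partition theorem\<close>

text \<open>Packaged as a predicate of \<open>S\<close>, \<open>k\<close> and \<open>F\<close> so
  that the pigeonhole argument can use its monotonicity. \<open>Max\<close> and \<open>Min\<close>
  are never taken of an empty set: \<open>\<beta>\<close> and \<open>\<gamma>\<close> are nonzero,
  and each has an empty domain on the other side.\<close>

definition has_configuration ::
    "real \<Rightarrow> real \<Rightarrow> (rat ^ 'l) set \<Rightarrow> nat \<Rightarrow> (rat ^ 'l) set \<Rightarrow> bool" where
  "has_configuration k1 k2 S k F \<longleftrightarrow> (\<exists>\<alpha>. \<exists>\<beta> \<in> UNIV - \<int>. \<exists>\<gamma> \<in> \<int> - {0}.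
      rat_dom_pos \<beta> = {} \<and> rat_dom_neg \<gamma> = {} \<and>
      real_of_int (Max (rat_dom_neg \<beta>)) < k1 \<and>
      k2 < real_of_int (Min (rat_dom_pos \<gamma>)) \<and>
      (\<forall>p q :: int. 0 \<le> p \<and> p \<le> int k \<and> 0 \<le> q \<and> q \<le> int k \<longrightarrow>
         (\<lambda>f. \<alpha> + (of_int p * \<beta> + of_int q * \<gamma>) *s f) ` F \<subseteq> S))"

lemma has_configuration_mono:
  assumes "has_configuration k1 k2 S k' F'" "k \<le> k'" "F \<subseteq> F'"
  shows "has_configuration k1 k2 S k F"
proof -
  from assms(1) obtain \<alpha> \<beta> \<gamma> where config: "\<beta> \<in> UNIV - \<int>" "\<gamma> \<in> \<int> - {0}"
      "rat_dom_pos \<beta> = {} \<and> rat_dom_neg \<gamma> = {} \<and>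
       real_of_int (Max (rat_dom_neg \<beta>)) < k1 \<and> k2 < real_of_int (Min (rat_dom_pos \<gamma>))"
    and sub: "\<forall>p q. 0 \<le> p \<and> p \<le> int k' \<and> 0 \<le> q \<and> q \<le> int k' \<longrightarrow>
      (\<lambda>f. \<alpha> + (of_int p * \<beta> + of_int q * \<gamma>) *s f) ` F' \<subseteq> S"
    unfolding has_configuration_def by blast
  have "(\<lambda>f. \<alpha> + (of_int p * \<beta> + of_int q * \<gamma>) *s f) ` F \<subseteq> S"
    if "0 \<le> p \<and> p \<le> int k \<and> 0 \<le> q \<and> q \<le> int k" for p q
  proof -
    have "0 \<le> p \<and> p \<le> int k' \<and> 0 \<le> q \<and> q \<le> int k'" using that assms(2) by linarith
    from sub[rule_format, OF this] show ?thesis using image_mono[OF assms(3)] by (rule subset_trans[rotated])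
  qed
  then show ?thesis
    unfolding has_configuration_def using config
    by (intro exI[of _ \<alpha>] bexI[of _ \<beta>] bexI[of _ \<gamma>]) simp_all
qed

text \<open>Here the class may still depend on \<open>k\<close> and \<open>F\<close>. A point may
  lie in several classes, so its colour is the index of a chosen one.\<close>

lemma ex_has_configuration:
  fixes Q :: "nat \<Rightarrow> (rat ^ 'l) set" and F :: "(rat ^ 'l) set" and k1 k2 :: real
  assumes Q: "UNIV = (\<Union>i\<in>{1..r}. Q i)" and F: "finite F" "F \<noteq> {}"
  shows "\<exists>i\<in>{1..r}. has_configuration k1 k2 (Q i) k F"
proof -
  have "\<forall>v. \<exists>i. i \<in> {1..r} \<and> v \<in> Q i" using Q by blast
  then obtain \<kappa> where \<kappa>: "\<And>v. \<kappa> v \<in> {1..r}" "\<And>v. v \<in> Q (\<kappa> v)" by metis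
  have "range \<kappa> \<subseteq> {1..r}" using \<kappa>(1) by blast
  then have fin: "finite (range \<kappa>)" using finite_subset by blast
  define m where "m = nat \<lceil>max (- k1) k2\<rceil> + 1"
  have m: "m \<ge> 1" "- k1 < real m" "k2 < real m" unfolding m_def by linarith+
  \<comment> \<open>There is one sequence for each triple of coefficients and vector. All of them
    are summed over the same \<open>A\<close>, so a single pair \<open>\<beta>\<close>,
    \<open>\<gamma>\<close> serves every triple.\<close>
  let ?E = "{0..int k} \<times> {0..int k} \<times> F"
  let ?x = "\<lambda>(p, q, f) i. (of_int p * weight (- int i) + of_int q * weight (int i)) *s f"
  have "finite ?E" "?E \<noteq> {}" using F by auto
  then obtain \<alpha> A c where A: "finite A" "A \<noteq> {}" "A \<subseteq> {m..}"
    and c: "\<forall>a\<in>?E. \<kappa> (\<alpha> + (\<Sum>i\<in>A. ?x a i)) = c"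
    by (rule ip_van_der_Waerden[OF _ _ fin])
  define \<beta> where "\<beta> = (\<Sum>i\<in>A. weight (- int i))"
  define \<gamma> where "\<gamma> = (\<Sum>i\<in>A. weight (int i))"
  note \<beta> = sum_weight_neg[OF A m(1,2), folded \<beta>_def]
  note \<gamma> = sum_weight_pos[OF A m(1,3), folded \<gamma>_def]
  have x: "(\<Sum>i\<in>A. ?x (p, q, f) i) = (of_int p * \<beta> + of_int q * \<gamma>) *s f" for p q f
    by (simp add: \<beta>_def \<gamma>_def vec_eq_iff sum_distrib_left sum.distrib
        flip: sum_distrib_right)
  have mem: "\<alpha> + (of_int p * \<beta> + of_int q * \<gamma>) *s f \<in> Q c"
    if "0 \<le> p \<and> p \<le> int k \<and> 0 \<le> q \<and> q \<le> int k" "f \<in> F" for p q f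
    using bspec[OF c, of "(p, q, f)"] \<kappa>(2)[of "\<alpha> + (of_int p * \<beta> + of_int q * \<gamma>) *s f"] that
    unfolding x by simp
  obtain f where "f \<in> F" using F by blast
  \<comment> \<open>Any point of the configuration shows that \<open>c\<close> is an actual colour;
    this is where \<open>F\<close> must be non-empty.\<close>
  then have "c \<in> {1..r}" using bspec[OF c, of "(0, 0, f)"] \<kappa>(1) by force
  moreover have "has_configuration k1 k2 (Q c) k F"
    unfolding has_configuration_def
    by (intro exI[of _ \<alpha>] bexI[of _ \<beta>] bexI[of _ \<gamma>] conjI \<beta>(2,3) \<gamma>)
       (use \<beta>(1) mem in auto)
  ultimately show ?thesis by blast
qed

section \<open>One class for all \<open>k\<close> and \<open>F\<close>\<close>

text \<open>If each \<open>i\<close> failed at some pair \<open>(k i, F i)\<close>, then by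
  monotonicity all of them would fail at the maximum of the \<open>k i\<close> and the union of the
  \<open>F i\<close>, contradicting \<open>ex\<close>.\<close>

lemma pigeonhole_directed:
  fixes P :: "'i \<Rightarrow> nat \<Rightarrow> 'a set \<Rightarrow> bool"
  assumes "finite I"
    and mono: "\<And>i k k' F F'. P i k' F' \<Longrightarrow> k \<le> k' \<Longrightarrow> F \<subseteq> F' \<Longrightarrow> P i k F"
    and ex: "\<And>k F. finite F \<Longrightarrow> F \<noteq> {} \<Longrightarrow> \<exists>i\<in>I. P i k F"
  shows "\<exists>i\<in>I. \<forall>k F. finite F \<longrightarrow> F \<noteq> {} \<longrightarrow> P i k F"
proof (rule ccontr)
  assume "\<not> ?thesis"
  then have "\<forall>i\<in>I. \<exists>k F. finite F \<and> F \<noteq> {} \<and> \<not> P i k F" by blast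
  then obtain k F where F: "\<forall>i\<in>I. finite (F i) \<and> F i \<noteq> {} \<and> \<not> P i (k i) (F i)"
    by metis
  \<comment> \<open>A singleton test set produces an element of \<open>I\<close>, without which the
    union below would be empty.\<close>
  have "I \<noteq> {}" using ex[of "{undefined}"] by blast
  then have "finite (\<Union>i\<in>I. F i)" "(\<Union>i\<in>I. F i) \<noteq> {}" using F \<open>finite I\<close> by blast+
  from ex[OF this] obtain i where "i \<in> I" "P i (Max (k ` I)) (\<Union>i\<in>I. F i)" by blast
  moreover from this have "P i (k i) (F i)"
    by (elim mono) (use \<open>finite I\<close> in auto)
  ultimately show False using F by blast
qed

theorem theorem3p3:
  fixes Q :: "nat \<Rightarrow> (rat ^ 'l) set" and r :: nat and k1 k2 :: real
  assumes "k1 < k2"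
    and "r \<ge> 1"
    and "(UNIV :: (rat ^ 'l) set) = (\<Union>i\<in>{1..r}. Q i)"
  shows "\<exists>i0\<in>{1..r}. \<forall>k::nat. \<forall>F :: (rat ^ 'l) set.
           k \<ge> 1 \<longrightarrow> finite F \<longrightarrow> F \<noteq> {} \<longrightarrow>
           (\<exists>\<alpha> :: rat ^ 'l. \<exists>\<beta> \<in> UNIV - \<int>. \<exists>\<gamma> \<in> \<int> - {0}.
              rat_dom_pos \<beta> = {} \<and> rat_dom_neg \<gamma> = {} \<and>
              real_of_int (Max (rat_dom_neg \<beta>)) < k1 \<and>
              k2 < real_of_int (Min (rat_dom_pos \<gamma>)) \<and>
              (\<forall>p q :: int. 0 \<le> p \<and> p \<le> int k \<and> 0 \<le> q \<and> q \<le> int k \<longrightarrow>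
                 (\<lambda>f. \<alpha> + (of_int p * \<beta> + of_int q * \<gamma>) *s f) ` F \<subseteq> Q i0))"
proof -
  have "\<exists>i\<in>{1..r}. \<forall>k F. finite F \<longrightarrow> F \<noteq> {} \<longrightarrow> has_configuration k1 k2 (Q i) k F"
    by (rule pigeonhole_directed)
       (simp, (rule has_configuration_mono; assumption), rule ex_has_configuration[OF assms(3)])
  then obtain i where "i \<in> {1..r}" and config:
    "\<forall>k F. finite F \<longrightarrow> F \<noteq> {} \<longrightarrow> has_configuration k1 k2 (Q i) k F" by blast
  show ?thesis
    by (intro bexI[OF _ \<open>i \<in> {1..r}\<close>] allI impI config[rule_format, unfolded has_configuration_def])
qed

end
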